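(* Let $A \in \mathbb{C}^{m \times n}$ and $W \in \mathbb{C}^{n \times m}$. Then $$A\{1',2',3'\}=\{(WAW)^{\dagger}+ (I_m-(WAW)^{\dagger}WAW)U(WAW)^{\dagger} \mid U \in \mathbb{C}^{m \times m}, \ r(WAW)=r(A) \}$$ and $$A\{1',2',4'\}=\{(WAW)^{\dagger}+ (WAW)^{\dagger}V(I_n-WAW(WAW)^{\dagger}) \mid V \in \mathbb{C}^{n \times n}, \ r(WAW)=r(A) \}.$$ (The right-hand sets are empty when $r(WAW)\neq r(A)$.)
   Context: $r(\cdot)$ denotes rank, $*$ conjugate transpose, $M^\dagger$ the Moore-Penrose inverse of $M$. For $A \in \mathbb{C}^{m \times n}$, $W \in \mathbb{C}^{n \times m}$: $A\{1',2',3'\}$ is the set of all $X \in \mathbb{C}^{m \times n}$ with $AWXWA=A$, $XWAWX=X$ and $(WAWX)^*=WAWX$; $A\{1',2',4'\}$ is the set of all $X \in \mathbb{C}^{m \times n}$ with $AWXWA=A$, $XWAWX=X$ and $(XWAW)^*=XWAW$. *)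

theory Defs
  imports "HOL-Analysis.Analysis"
begin

text \<open>A matrix with m rows and n columns has type \<open>complex^'n^'m\<close> (column index type first).\<close>

definition conj_transpose :: "complex^'n^'m \<Rightarrow> complex^'m^'n"
  where "conj_transpose M = map_matrix cnj (transpose M)"

definition is_moore_penrose :: "complex^'n^'m \<Rightarrow> complex^'m^'n \<Rightarrow> bool"
  where "is_moore_penrose M X \<longleftrightarrow>
    M ** X ** M = M \<and>
    X ** M ** X = X \<and>
    conj_transpose (M ** X) = M ** X \<and>
    conj_transpose (X ** M) = X ** M"

text \<open>By Penrose's theorem, the four equations have exactly one solution for every complex
  matrix, so the description below is always proper.\<close>

definition moore_penrose :: "complex^'n^'m \<Rightarrow> complex^'m^'n"
  where "moore_penrose M = (THE X. is_moore_penrose M X)"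

text \<open>The sets \<open>A{1',2',3'}\<close> and \<open>A{1',2',4'}\<close>, with the dependence on the weight \<open>W\<close>
  made explicit.\<close>

definition inverses_123 :: "complex^'n^'m \<Rightarrow> complex^'m^'n \<Rightarrow> (complex^'n^'m) set"
  where "inverses_123 A W = {X.
    A ** W ** X ** W ** A = A \<and>
    X ** W ** A ** W ** X = X \<and>
    conj_transpose (W ** A ** W ** X) = W ** A ** W ** X}"

definition inverses_124 :: "complex^'n^'m \<Rightarrow> complex^'m^'n \<Rightarrow> (complex^'n^'m) set"
  where "inverses_124 A W = {X.
    A ** W ** X ** W ** A = A \<and>
    X ** W ** A ** W ** X = X \<and>
    conj_transpose (X ** W ** A ** W) = X ** W ** A ** W}"

end

theory Submission
  imports Defs
begin

text \<open>Write \<open>M = WAW\<close>. The condition \<open>XWAWX = X\<close> says \<open>XMX = X\<close>, while \<open>AWXWA = A\<close> is equivalent to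
  \<open>MXM = M\<close> together with \<open>r(M) = r(A)\<close>: it exhibits \<open>A\<close> as a two-sided multiple of \<open>M\<close>, and
  conversely equality of ranks allows one to cancel the outer factors \<open>W\<close>. Hence
  \<open>A{1',2',3'}\<close> is the set of \<open>{1,2,3}\<close>-inverses of \<open>M\<close>, which satisfy \<open>MX = MM\<^sup>\<dagger>\<close> because both
  are the orthogonal projector onto the range of \<open>M\<close>; so \<open>X = M\<^sup>\<dagger> + (I - M\<^sup>\<dagger>M)XMM\<^sup>\<dagger>\<close>.\<close>

section \<open>Rank and one-sided cancellation\<close>

lemma matrix_diff_ldistrib: "A ** (B - C) = A ** B - A ** C" for A :: "'a::ring_1^'n^'m"
  by (vector matrix_matrix_mult_def right_diff_distrib sum_subtractf)

lemma matrix_diff_rdistrib: "(A - B) ** C = A ** C - B ** C" for A :: "'a::ring_1^'n^'m"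
  by (vector matrix_matrix_mult_def left_diff_distrib sum_subtractf)

lemma matrix_add_rdistrib: "(A + B) ** C = A ** C + B ** C" for A :: "'a::semiring_1^'n^'m"
  by (vector matrix_matrix_mult_def distrib_right sum.distrib)

lemma matrix_zero_right [simp]: "A ** 0 = 0" for A :: "'a::semiring_1^'n^'m"
  by (vector matrix_matrix_mult_def)

text \<open>Viewing the row space as a range makes the row space of \<open>B ** C\<close> the image
  of that of \<open>B\<close> under \<open>transpose C\<close>, which gives both rank bounds for
  products.\<close>

lemma rank_eq_dim_range_transpose:
  fixes A :: "'a::field^'n^'m"
  shows "rank A = vec.dim (range ((*v) (transpose A)))"
proof -
  have "rows A \<subseteq> range ((*v) (transpose A))"
  proof
    fix r assume "r \<in> rows A"
    then obtain i where "r = row i A" by (auto simp: rows_def)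
    also have "\<dots> = transpose A *v axis i 1"
      by (simp add: vec_eq_iff row_def transpose_def matrix_vector_mult_def axis_def if_distrib cong: if_cong)
    finally show "r \<in> range ((*v) (transpose A))" by blast
  qed
  moreover have "range ((*v) (transpose A)) \<subseteq> vec.span (rows A)"
    using matrix_vector_mult_in_columnspace_gen[of "transpose A"] by auto
  ultimately show ?thesis
    unfolding row_rank_def_gen by (metis vec.dim_subset vec.dim_span le_antisym)
qed

lemma range_transpose_mult:
  fixes B :: "'a::field^'n^'m" and C :: "'a^'p^'n"
  shows "range ((*v) (transpose (B ** C))) = (*v) (transpose C) ` range ((*v) (transpose B))"
  by (simp only: image_comp o_def matrix_transpose_mul matrix_vector_mul_assoc)

lemma subspace_range_matrix: "vec.subspace (range ((*v) A))" for A :: "'a::field^'n^'m"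
  by (rule vec.subspace_image[OF vec.subspace_UNIV])

lemma rank_mult_le_left:
  fixes B :: "'a::field^'n^'m" and C :: "'a^'p^'n"
  shows "rank (B ** C) \<le> rank B"
  unfolding rank_eq_dim_range_transpose range_transpose_mult
  by (rule vec.dim_image_le[OF matrix_vector_mul_linear_gen])

lemma rank_mult_le_right:
  fixes B :: "'a::field^'n^'m" and C :: "'a^'p^'n"
  shows "rank (B ** C) \<le> rank C"
  unfolding rank_eq_dim_range_transpose range_transpose_mult
  by (rule vec.dim_subset) auto

text \<open>\<open>Y\<close> is \<open>A\<close> followed by a linear right inverse of
  \<open>B\<close> on its range.\<close>

lemma matrix_factor_if_range_subset:
  fixes A :: "'a::field^'n^'m" and B :: "'a^'p^'m"
  assumes "range ((*v) A) \<subseteq> range ((*v) B)"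
  obtains Y where "A = B ** Y"
proof -
  obtain g where g: "Vector_Spaces.linear (*s) (*s) g"
      and inv: "\<And>v. v \<in> range ((*v) B) \<Longrightarrow> B *v g v = v"
    using vec.linear_exists_right_inverse_on[OF matrix_vector_mul_linear_gen vec.subspace_UNIV]
    by metis
  have "A = B ** (matrix g ** A)"
    unfolding matrix_eq
  proof
    fix x
    have "B *v g (A *v x) = A *v x" by (rule inv) (use assms in auto)
    then show "A *v x = B ** (matrix g ** A) *v x"
      by (simp add: matrix_vector_mul_assoc[symmetric] matrix_works[OF g] del: transpose_matrix_vector)
  qed
  then show thesis by (rule that)
qed

text \<open>The row space of \<open>B ** C\<close> lies in that of \<open>C\<close>; equal
  dimensions make them equal, so the transposes factor.\<close>

lemma rank_mult_eq_right_cancel: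
  fixes B :: "'a::field^'n^'m" and C :: "'a^'p^'n"
  assumes "rank (B ** C) = rank C"
  obtains Z where "C = Z ** (B ** C)"
proof -
  have sub: "range ((*v) (transpose (B ** C))) \<subseteq> range ((*v) (transpose C))"
    unfolding range_transpose_mult by blast
  have "range ((*v) (transpose (B ** C))) = range ((*v) (transpose C))"
    by (rule vec.subspace_dim_equal[OF subspace_range_matrix subspace_range_matrix sub])
      (simp only: rank_eq_dim_range_transpose[symmetric] assms)
  then obtain Y where "transpose C = transpose (B ** C) ** Y"
    by (metis matrix_factor_if_range_subset order_refl)
  then have "C = transpose Y ** (B ** C)"
    by (metis matrix_transpose_mul transpose_transpose)
  then show thesis by (rule that)
qed

text \<open>The rank of the library is the row rank, so the left-hand version is not obtained from the
  previous lemma by transposition; instead \<open>v \<mapsto> vC\<close> is injective on the row space of \<open>B\<close>.\<close>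

lemma rank_mult_eq_left_cancel:
  fixes B :: "'a::field^'n^'m" and C :: "'a^'p^'n"
  assumes "rank (B ** C) = rank B"
  obtains Y where "B = (B ** C) ** Y"
proof -
  define S where "S = range ((*v) (transpose B))"
  let ?f = "(*v) (transpose C)"
  have S: "vec.subspace S" unfolding S_def by (rule subspace_range_matrix)
  obtain g where gS: "range g \<subseteq> S" and g: "Vector_Spaces.linear (*s) (*s) g"
      and inv: "\<And>v. v \<in> ?f ` S \<Longrightarrow> ?f (g v) = v"
    using vec.linear_exists_right_inverse_on[OF matrix_vector_mul_linear_gen S] by metis
  interpret g: Vector_Spaces.linear "(*s)" "(*s)" g by (rule g)
  have fS: "vec.subspace (?f ` S)"
    by (rule vec.subspace_image[OF S])
  \<comment> \<open>As dim S = dim f(S) = dim f(g(f(S))) is at most dim g(f(S)), the subspace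
    g(f(S)) of S is all of S.\<close>
  have "vec.dim S = vec.dim (?f ` S)"
    using assms unfolding rank_eq_dim_range_transpose range_transpose_mult S_def by simp
  also have "?f ` S = ?f ` g ` ?f ` S"
    using inv by (force simp: image_iff)
  also have "vec.dim \<dots> \<le> vec.dim (g ` ?f ` S)"
    by (rule vec.dim_image_le[OF matrix_vector_mul_linear_gen])
  finally have "g ` ?f ` S = S"
    using gS by (intro vec.subspace_dim_equal g.subspace_image[OF fS] S) auto
  \<comment> \<open>Write s = g(f(t)); then f(g(f(t))) = f(t) gives g(f(s)) = s.\<close>
  then have gf: "g (?f s) = s" if "s \<in> S" for s
    using that inv by (metis (no_types, lifting) imageE imageI)
  have "transpose B = matrix g ** (transpose C ** transpose B)"
    unfolding matrix_eq
  proof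
    fix x
    have "g (?f (transpose B *v x)) = transpose B *v x" by (rule gf) (simp add: S_def del: transpose_matrix_vector)
    then show "transpose B *v x = matrix g ** (transpose C ** transpose B) *v x"
      by (simp add: matrix_vector_mul_assoc[symmetric] matrix_works[OF g] del: transpose_matrix_vector)
  qed
  then have "B = (B ** C) ** transpose (matrix g)"
    by (metis matrix_transpose_mul transpose_transpose)
  then show thesis by (rule that)
qed

section \<open>The Moore-Penrose inverse\<close>

lemma conj_transpose_mult: "conj_transpose (A ** B) = conj_transpose B ** conj_transpose A"
  by (simp add: conj_transpose_def vec_eq_iff matrix_matrix_mult_def transpose_def mult.commute)

lemma conj_transpose_conj_transpose [simp]: "conj_transpose (conj_transpose A) = A"
  by (simp add: conj_transpose_def vec_eq_iff transpose_def)

text \<open>The diagonal entries of the Gram matrix are the squared column norms of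
  \<open>N\<close>.\<close>

lemma conj_transpose_mult_self_eq_0:
  assumes "conj_transpose N ** N = 0"
  shows "N = 0"
proof -
  have "N $ k $ i = 0" for k i
  proof -
    have "0 = (conj_transpose N ** N) $ i $ i" using assms by simp
    also have "\<dots> = of_real (\<Sum>k\<in>UNIV. (cmod (N $ k $ i))\<^sup>2)"
      by (simp add: conj_transpose_def matrix_matrix_mult_def transpose_def
          complex_norm_square mult.commute del: of_real_power)
    finally have "(\<Sum>k\<in>UNIV. (cmod (N $ k $ i))\<^sup>2) = 0"
      by (metis of_real_eq_0_iff)
    then show ?thesis by (simp add: sum_nonneg_eq_0_iff)
  qed
  then show ?thesis by (simp add: vec_eq_iff)
qed

lemma matrix_inner_inverse_exists:
  fixes C :: "'a::field^'n^'m"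
  obtains G where "C ** G ** C = C"
proof -
  obtain g where g: "Vector_Spaces.linear (*s) (*s) g"
      and inv: "\<And>v. v \<in> range ((*v) C) \<Longrightarrow> C *v g v = v"
    using vec.linear_exists_right_inverse_on[OF matrix_vector_mul_linear_gen vec.subspace_UNIV]
    by metis
  have "C ** matrix g ** C = C"
    by (simp add: matrix_eq matrix_vector_mul_assoc[symmetric] matrix_works[OF g] inv)
  then show thesis by (rule that)
qed

text \<open>For an inner inverse \<open>G\<close> of the Gram matrix, the residual \<open>N\<close>
  is killed by the adjoint of \<open>M\<close> and has \<open>M\<close> as a left factor, so its own
  Gram matrix vanishes.\<close>

lemma gram_left_cancel:
  fixes M :: "complex^'n^'m"
  obtains Z where "M = Z ** (conj_transpose M ** M)"
proof -
  let ?C = "conj_transpose M ** M"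
  obtain G where G: "?C ** G ** ?C = ?C" by (rule matrix_inner_inverse_exists)
  define N where "N = M - M ** G ** ?C"
  have "conj_transpose M ** N = 0"
    using G by (simp add: N_def matrix_diff_ldistrib matrix_mul_assoc)
  moreover have "N = M ** (mat 1 - G ** ?C)"
    by (simp add: N_def matrix_diff_ldistrib matrix_mul_assoc)
  ultimately have "conj_transpose N ** N = 0"
    by (metis conj_transpose_mult matrix_mul_assoc matrix_zero_right)
  then have "N = 0" by (rule conj_transpose_mult_self_eq_0)
  then have "M = (M ** G) ** ?C" by (simp add: N_def)
  then show thesis by (rule that)
qed

text \<open>The adjoint of the Gram cofactor \<open>Z\<close> serves as \<open>G\<close>: then
  \<open>M ** G\<close> equals \<open>Z ** conj_transpose M\<close>, which is its own
  adjoint.\<close>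

lemma inverse_13_exists:
  fixes M :: "complex^'n^'m"
  obtains G where "M ** G ** M = M" "conj_transpose (M ** G) = M ** G"
proof -
  obtain Z where Z: "M = Z ** (conj_transpose M ** M)" by (rule gram_left_cancel)
  let ?G = "conj_transpose Z"
  have adj: "conj_transpose M ** M ** ?G = conj_transpose M"
    using arg_cong[OF Z, of conj_transpose] by (simp add: conj_transpose_mult)
  have adj': "conj_transpose (M ** ?G) = Z ** conj_transpose M"
    by (simp add: conj_transpose_mult)
  have "Z ** conj_transpose M = (Z ** (conj_transpose M ** M)) ** ?G"
    by (metis adj matrix_mul_assoc)
  then have eq: "Z ** conj_transpose M = M ** ?G" using Z by simp
  have "M ** ?G ** M = M" using Z eq by (metis matrix_mul_assoc)
  with adj' eq show thesis by (intro that[of ?G]) simp_all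
qed

text \<open>Urquhart's formula: \<open>HMG\<close> is the Moore-Penrose inverse for a \<open>{1,4}\<close>-inverse \<open>H\<close> and a
  \<open>{1,3}\<close>-inverse \<open>G\<close>.\<close>

lemma moore_penrose_exists:
  fixes M :: "complex^'n^'m"
  shows "\<exists>X. is_moore_penrose M X"
proof -
  obtain G where G: "M ** G ** M = M" "conj_transpose (M ** G) = M ** G"
    by (rule inverse_13_exists)
  obtain K where K: "conj_transpose M ** K ** conj_transpose M = conj_transpose M"
      "conj_transpose (conj_transpose M ** K) = conj_transpose M ** K"
    by (rule inverse_13_exists)
  \<comment> \<open>The adjoint of a {1,3}-inverse of the adjoint of \<open>M\<close> is a
    {1,4}-inverse of \<open>M\<close>.\<close>
  define H where "H = conj_transpose K"
  have H1: "M ** H ** M = M"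
    using arg_cong[OF K(1), of conj_transpose] by (simp add: H_def conj_transpose_mult matrix_mul_assoc)
  have H4: "conj_transpose (H ** M) = H ** M"
    using K(2) by (simp add: H_def conj_transpose_mult)
  have MX: "M ** (H ** M ** G) = M ** G" by (metis H1 matrix_mul_assoc)
  have XM: "H ** M ** G ** M = H ** M" by (metis G(1) matrix_mul_assoc)
  have "H ** M ** G ** M ** (H ** M ** G) = H ** M ** G"
    by (metis XM MX matrix_mul_assoc)
  then have "is_moore_penrose M (H ** M ** G)"
    unfolding is_moore_penrose_def MX XM using G H4 by simp
  then show ?thesis by blast
qed

text \<open>Projectors onto the same range fix each other from the left; taking adjoints reverses
  the product and identifies them.\<close>

lemma hermitian_left_projector_unique:
  assumes "M ** X ** M = M" "conj_transpose (M ** X) = M ** X"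
    and "M ** Y ** M = M" "conj_transpose (M ** Y) = M ** Y"
  shows "M ** X = M ** Y"
proof -
  have "M ** X = (M ** Y) ** (M ** X)" by (metis assms(3) matrix_mul_assoc)
  also have "\<dots> = conj_transpose ((M ** X) ** (M ** Y))"
    by (simp add: conj_transpose_mult[of "M ** X"] assms)
  also have "(M ** X) ** (M ** Y) = M ** Y" by (metis assms(1) matrix_mul_assoc)
  finally show ?thesis by (simp add: assms)
qed

text \<open>Dual case: the projectors share the kernel of \<open>M\<close> instead of its
  range.\<close>

lemma hermitian_right_projector_unique:
  assumes "M ** X ** M = M" "conj_transpose (X ** M) = X ** M"
    and "M ** Y ** M = M" "conj_transpose (Y ** M) = Y ** M"
  shows "X ** M = Y ** M"
proof -
  have "X ** M = (X ** M) ** (Y ** M)" by (metis assms(3) matrix_mul_assoc)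
  also have "\<dots> = conj_transpose ((Y ** M) ** (X ** M))"
    by (simp add: conj_transpose_mult[of "Y ** M"] assms)
  also have "(Y ** M) ** (X ** M) = Y ** M" by (metis assms(1) matrix_mul_assoc)
  finally show ?thesis by (simp add: assms)
qed

lemma is_moore_penrose_unique:
  assumes "is_moore_penrose M X" "is_moore_penrose M Y"
  shows "X = Y"
proof -
  have "M ** X = M ** Y" "X ** M = Y ** M"
    using assms hermitian_left_projector_unique[of M X Y] hermitian_right_projector_unique[of M X Y]
    by (simp_all add: is_moore_penrose_def)
  \<comment> \<open>X = XMX = XMY = YMY = Y.\<close>
  then show ?thesis
    using assms unfolding is_moore_penrose_def by (metis matrix_mul_assoc)
qed

lemma is_moore_penrose_moore_penrose: "is_moore_penrose M (moore_penrose M)"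
  unfolding moore_penrose_def
  using moore_penrose_exists is_moore_penrose_unique by (metis (no_types) theI)

section \<open>Parametrisation of the inverses\<close>

lemma inverse_123_iff:
  fixes M :: "complex^'n^'m"
  assumes "is_moore_penrose M P"
  shows "M ** X ** M = M \<and> X ** M ** X = X \<and> conj_transpose (M ** X) = M ** X \<longleftrightarrow>
    (\<exists>U. X = P + (mat 1 - P ** M) ** U ** P)" (is "?L \<longleftrightarrow> ?R")
proof -
  have P: "M ** P ** M = M" "P ** M ** P = P" "conj_transpose (M ** P) = M ** P"
    using assms by (auto simp: is_moore_penrose_def)
  show ?thesis
  proof
    assume L: ?L
    then have MX: "M ** X = M ** P"
      using P hermitian_left_projector_unique by blast
    have "X ** M ** P = X" by (metis L MX matrix_mul_assoc)
    moreover have "P ** M ** X = P" by (metis P(2) MX matrix_mul_assoc)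
    \<comment> \<open>Witness U = XM: the correction is XMP - PMXMP = X - P.\<close>
    ultimately have "X = P + (mat 1 - P ** M) ** (X ** M) ** P"
      by (simp add: matrix_diff_rdistrib matrix_mul_assoc[symmetric])
    then show ?R by blast
  next
    assume ?R
    then obtain U where X: "X = P + (mat 1 - P ** M) ** U ** P" by blast
    \<comment> \<open>M(I - PM) = 0, so the correction does not affect MX, whatever \<open>U\<close>
      is.\<close>
    have "M ** ((mat 1 - P ** M) ** U ** P) = (M - M ** P ** M) ** U ** P"
      by (simp add: matrix_diff_ldistrib matrix_mul_assoc)
    then have MX: "M ** X = M ** P" by (simp add: X matrix_add_ldistrib P)
    \<comment> \<open>Both summands of \<open>X\<close> end in \<open>P\<close>, and PMP = P absorbs
      the factor MP.\<close>
    have "X ** M ** X = X ** (M ** P)" by (metis MX matrix_mul_assoc)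
    also have "\<dots> = P ** M ** P + (mat 1 - P ** M) ** U ** (P ** M ** P)"
      by (simp add: X matrix_add_rdistrib matrix_mul_assoc)
    finally have "X ** M ** X = X" by (simp add: P X)
    with MX P show ?L by simp
  qed
qed

text \<open>Now XM = PM is the fixed product, so the freedom sits to the right of \<open>P\<close>,
  in a factor I - MP with (I - MP)M = 0.\<close>

lemma inverse_124_iff:
  fixes M :: "complex^'n^'m"
  assumes "is_moore_penrose M P"
  shows "M ** X ** M = M \<and> X ** M ** X = X \<and> conj_transpose (X ** M) = X ** M \<longleftrightarrow>
    (\<exists>V. X = P + P ** V ** (mat 1 - M ** P))" (is "?L \<longleftrightarrow> ?R")
proof -
  have P: "M ** P ** M = M" "P ** M ** P = P" "conj_transpose (P ** M) = P ** M"
    using assms by (auto simp: is_moore_penrose_def)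
  show ?thesis
  proof
    assume L: ?L
    then have XM: "X ** M = P ** M"
      using P hermitian_right_projector_unique by blast
    have "P ** M ** X = X" by (metis L XM)
    moreover have "P ** M ** X ** M ** P = P" by (metis L P(2) XM)
    \<comment> \<open>Witness V = MX: the correction is PMX - PMXMP = X - P.\<close>
    ultimately have "X = P + P ** (M ** X) ** (mat 1 - M ** P)"
      by (simp add: matrix_diff_ldistrib matrix_mul_assoc)
    then show ?R by blast
  next
    assume ?R
    then obtain V where X: "X = P + P ** V ** (mat 1 - M ** P)" by blast
    have "P ** V ** (mat 1 - M ** P) ** M = P ** V ** (M - M ** P ** M)"
      by (simp add: matrix_diff_rdistrib matrix_mul_assoc[symmetric])
    then have XM: "X ** M = P ** M" by (simp add: X matrix_add_rdistrib P)
    have "X ** M ** X = P ** M ** P + P ** M ** P ** V ** (mat 1 - M ** P)"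
      unfolding XM by (simp add: X matrix_add_ldistrib matrix_mul_assoc)
    then have "X ** M ** X = X" by (simp add: P X)
    moreover have "M ** X ** M = M" by (metis XM P(1) matrix_mul_assoc)
    ultimately show ?L using XM P by simp
  qed
qed

lemma weighted_inner_inverse_iff:
  fixes A :: "'a::field^'n^'m" and W :: "'a^'m^'n"
  assumes "M = W ** A ** W"
  shows "A ** W ** X ** W ** A = A \<longleftrightarrow> M ** X ** M = M \<and> rank M = rank A"
    (is "?L \<longleftrightarrow> ?R")
proof
  assume L: ?L
  have "M ** X ** M = W ** (A ** W ** X ** W ** A) ** W"
    by (simp add: assms matrix_mul_assoc)
  then have "M ** X ** M = M" by (simp add: L assms)
  moreover have "rank M \<le> rank A"
    unfolding assms using rank_mult_le_left rank_mult_le_right order_trans by blast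
  moreover have "rank A \<le> rank M"
  proof -
    \<comment> \<open>Substituting the equation into itself places M = WAW in the middle of a
      product equal to \<open>A\<close>.\<close>
    have "A ** W ** X ** M ** X ** W ** A = (A ** W ** X ** W ** A) ** W ** X ** W ** A"
      by (simp add: assms matrix_mul_assoc)
    also have "\<dots> = A" by (simp add: L)
    finally have "A = (A ** W ** X) ** (M ** (X ** W ** A))"
      by (simp add: matrix_mul_assoc)
    then show ?thesis
      by (metis rank_mult_le_left rank_mult_le_right order_trans)
  qed
  ultimately show ?R by simp
next
  assume R: ?R
  \<comment> \<open>With rank M = rank A, these bounds force AW and WA to have that rank too, which
    permits all three cancellations below.\<close>
  have le: "rank (A ** W) \<le> rank A" "rank (W ** A) \<le> rank A"
      "rank M \<le> rank (A ** W)" "rank M \<le> rank (W ** A)"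
    unfolding assms by (metis rank_mult_le_left rank_mult_le_right matrix_mul_assoc)+
  obtain Y where Y: "A = A ** W ** Y"
    by (rule rank_mult_eq_left_cancel[of A W]) (use le R in auto)
  obtain Z where Z: "A ** W = Z ** M"
    using rank_mult_eq_right_cancel[of W "A ** W"] le R
    by (metis assms le_antisym matrix_mul_assoc)
  obtain T where T: "W ** A = M ** T"
    using rank_mult_eq_left_cancel[of "W ** A" W] le R by (metis assms le_antisym)
  \<comment> \<open>A = AWY = ZMY = ZW(AWY) = ZWA.\<close>
  have A: "A = Z ** (W ** A)"
    using Y Z by (metis assms matrix_mul_assoc)
  have "A ** W ** X ** W ** A = (A ** W) ** X ** (W ** A)"
    by (simp add: matrix_mul_assoc)
  also have "\<dots> = Z ** (M ** X ** M) ** T"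
    by (simp add: Z T matrix_mul_assoc)
  also have "\<dots> = A" using R A T by (simp add: matrix_mul_assoc)
  finally show ?L .
qed

theorem theorem2p6:
  fixes A :: "complex^'n^'m" and W :: "complex^'m^'n"
  shows "inverses_123 A W =
      {moore_penrose (W ** A ** W)
         + (mat 1 - moore_penrose (W ** A ** W) ** (W ** A ** W)) ** U ** moore_penrose (W ** A ** W)
       | U :: complex^'m^'m. rank (W ** A ** W) = rank A}
    \<and> inverses_124 A W =
      {moore_penrose (W ** A ** W)
         + moore_penrose (W ** A ** W) ** V ** (mat 1 - (W ** A ** W) ** moore_penrose (W ** A ** W))
       | V :: complex^'n^'n. rank (W ** A ** W) = rank A}"
proof -
  define M where "M = W ** A ** W"
  have MX: "W ** A ** W ** X = M ** X" and XM: "X ** W ** A ** W = X ** M" for X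
    by (simp_all add: M_def matrix_mul_assoc)
  note P = is_moore_penrose_moore_penrose[of M]
  note inner = weighted_inner_inverse_iff[OF M_def]
  have "inverses_123 A W = {X. rank M = rank A \<and>
      (M ** X ** M = M \<and> X ** M ** X = X \<and> conj_transpose (M ** X) = M ** X)}"
    unfolding inverses_123_def inner XM MX by blast
  moreover have "inverses_124 A W = {X. rank M = rank A \<and>
      (M ** X ** M = M \<and> X ** M ** X = X \<and> conj_transpose (X ** M) = X ** M)}"
    unfolding inverses_124_def inner XM by blast
  \<comment> \<open>The rank condition does not involve \<open>U\<close> or \<open>V\<close>, so it
    moves out of the existential; where it fails, both sides are empty.\<close>
  ultimately show ?thesis
    unfolding inverse_123_iff[OF P] inverse_124_iff[OF P] M_def[symmetric] by blast
qed

end
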